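(* Let $\mathcal{M}_1 = (V, \mathcal{I}_1)$ and $\mathcal{M}_2 = (V, \mathcal{I}_2)$ be two matroids on the same ground set $V$, with ranks $r_1$ and $r_2$ respectively, and let $r$ be the maximum cardinality of a common independent set. For any $\varepsilon > 0$, there is a deterministic semi-streaming algorithm that finds a common independent set $S \in \mathcal{I}_1 \cap \mathcal{I}_2$ with $|S| \geq (2/3 - \varepsilon) r$, using $O(\frac{r_1 + r_2}{\varepsilon})$ memory and $O(\frac{1}{\varepsilon})$ passes.
   Context: A matroid $\mathcal{M} = (V,\mathcal{I})$ is given by a finite ground set $V$ and a nonempty family $\mathcal{I}\subseteq 2^V$ of independent sets satisfying the downward closure and augmentation properties; its rank is the maximum size of an independent set. A common independent set is a set in $\mathcal{I}_1\cap\mathcal{I}_2$. In the (adversarial-order) streaming model, the elements of $V$ arrive one by one in an arbitrary order, and the algorithm may read this stream multiple times (each full read is a pass); it can only store a limited number of elements (memory measured in number of stored elements), and it may test independence in $\mathcal{M}_1$ or $\mathcal{M}_2$ of any set consisting of stored elements and the currently arriving element. A semi-streaming algorithm for matroid intersection uses memory $O((r_1+r_2)\,\mathrm{polylog}(r_1+r_2))$. *)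

theory Defs
  imports Complex_Main "HOL-Library.Log_Nat"
begin

locale matroid =
  fixes V :: "'a set" and \<I> :: "'a set set"
  assumes finite_ground: "finite V"
    and indep_subset_ground: "\<I> \<subseteq> Pow V"
    and indep_nonempty: "\<I> \<noteq> {}"
    and indep_downward: "X \<in> \<I> \<Longrightarrow> Y \<subseteq> X \<Longrightarrow> Y \<in> \<I>"
    and indep_augment:
      "X \<in> \<I> \<Longrightarrow> Y \<in> \<I> \<Longrightarrow> card X < card Y \<Longrightarrow> \<exists>y \<in> Y - X. insert y X \<in> \<I>"

definition matroid_rank :: "'a set set \<Rightarrow> nat" where
  "matroid_rank \<I> = Max (card ` \<I>)"

definition max_common :: "'a set set \<Rightarrow> 'a set set \<Rightarrow> nat" where
  "max_common \<I>1 \<I>2 = Max (card ` (\<I>1 \<inter> \<I>2))"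

text \<open>
  Elements are opaque to a streaming algorithm: it refers to the available ones (the stored ones
  and, while one is being processed, the arriving one) by their position in a list. All it can learn
  about them is which positions hold the same element and which sets of positions are independent
  in either matroid. An algorithm is therefore a record over positions only. Local computation is
  not charged, so what it does at each event is an arbitrary function of this information; every
  adaptive sequence of permitted independence tests gives rise to such a function.
\<close>

record oracle_view =
  num_avail :: nat
  same_elem :: "nat \<Rightarrow> nat \<Rightarrow> bool"
  indep1 :: "nat set \<Rightarrow> bool"
  indep2 :: "nat set \<Rightarrow> bool"

definition view_of :: "'a set set \<Rightarrow> 'a set set \<Rightarrow> 'a list \<Rightarrow> oracle_view" where
  "view_of \<I>1 \<I>2 es =
     \<lparr> num_avail = length es,
       same_elem = (\<lambda>i j. i < length es \<and> j < length es \<and> es ! i = es ! j),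
       indep1 = (\<lambda>J. J \<subseteq> {..<length es} \<and> (!) es ` J \<in> \<I>1),
       indep2 = (\<lambda>J. J \<subseteq> {..<length es} \<and> (!) es ` J \<in> \<I>2) \<rparr>"

text \<open>
  The auxiliary data of an algorithm is a list of natural numbers (counters, labels of stored
  elements, the current phase). It is metered in bits, see \<open>aux_bits\<close> below: if it were free, an
  algorithm could record the whole input in it and the number of stored elements would no longer be
  a meaningful measure of memory.

  \<open>on_arrival\<close> and \<open>on_pass_end\<close> return the new auxiliary data and the positions of the elements to
  be kept. During an arrival, the arriving element is at the last position.
\<close>

record stream_alg =
  init_aux :: "nat list"
  on_arrival :: "nat list \<Rightarrow> oracle_view \<Rightarrow> nat list \<times> nat list"
  on_pass_end :: "nat list \<Rightarrow> oracle_view \<Rightarrow> nat list \<times> nat list"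
  num_passes :: nat
  final_choice :: "nat list \<Rightarrow> oracle_view \<Rightarrow> nat set"

type_synonym 'a config = "nat list \<times> 'a list"

definition keep :: "'a list \<Rightarrow> nat list \<Rightarrow> 'a list" where
  "keep es is = map ((!) es) (filter (\<lambda>i. i < length es) is)"

definition arrival_step ::
  "stream_alg \<Rightarrow> 'a set set \<Rightarrow> 'a set set \<Rightarrow> 'a \<Rightarrow> 'a config \<Rightarrow> 'a config" where
  "arrival_step A \<I>1 \<I>2 e = (\<lambda>(aux, mem).
     let es = mem @ [e]; (aux', is) = on_arrival A aux (view_of \<I>1 \<I>2 es)
     in (aux', keep es is))"

definition pass_end_step ::
  "stream_alg \<Rightarrow> 'a set set \<Rightarrow> 'a set set \<Rightarrow> 'a config \<Rightarrow> 'a config" where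
  "pass_end_step A \<I>1 \<I>2 = (\<lambda>(aux, mem).
     let (aux', is) = on_pass_end A aux (view_of \<I>1 \<I>2 mem)
     in (aux', keep mem is))"

definition run_pass ::
  "stream_alg \<Rightarrow> 'a set set \<Rightarrow> 'a set set \<Rightarrow> 'a list \<Rightarrow> 'a config \<Rightarrow> 'a config" where
  "run_pass A \<I>1 \<I>2 xs c = pass_end_step A \<I>1 \<I>2 (fold (arrival_step A \<I>1 \<I>2) xs c)"

definition after_passes ::
  "stream_alg \<Rightarrow> 'a set set \<Rightarrow> 'a set set \<Rightarrow> 'a list \<Rightarrow> nat \<Rightarrow> 'a config" where
  "after_passes A \<I>1 \<I>2 xs p = (run_pass A \<I>1 \<I>2 xs ^^ p) (init_aux A, [])"

definition configs ::
  "stream_alg \<Rightarrow> 'a set set \<Rightarrow> 'a set set \<Rightarrow> 'a list \<Rightarrow> 'a config set" where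
  "configs A \<I>1 \<I>2 xs =
     {fold (arrival_step A \<I>1 \<I>2) (take i xs) (after_passes A \<I>1 \<I>2 xs p) | p i.
        p < num_passes A \<and> i \<le> length xs}
     \<union> {after_passes A \<I>1 \<I>2 xs (num_passes A)}"

definition alg_result ::
  "stream_alg \<Rightarrow> 'a set set \<Rightarrow> 'a set set \<Rightarrow> 'a list \<Rightarrow> 'a set" where
  "alg_result A \<I>1 \<I>2 xs = (case after_passes A \<I>1 \<I>2 xs (num_passes A) of (aux, mem) \<Rightarrow>
     (!) mem ` (final_choice A aux (view_of \<I>1 \<I>2 mem) \<inter> {..<length mem}))"

definition peak_elems :: "stream_alg \<Rightarrow> 'a set set \<Rightarrow> 'a set set \<Rightarrow> 'a list \<Rightarrow> nat" where
  "peak_elems A \<I>1 \<I>2 xs = Max ((\<lambda>(aux, mem). length mem) ` configs A \<I>1 \<I>2 xs)"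

text \<open>Binary length of each number, plus one so that zeros are not free.\<close>

definition aux_bits :: "nat list \<Rightarrow> nat" where
  "aux_bits aux = (\<Sum>w\<leftarrow>aux. floorlog 2 w + 1)"

definition peak_aux_bits :: "stream_alg \<Rightarrow> 'a set set \<Rightarrow> 'a set set \<Rightarrow> 'a list \<Rightarrow> nat" where
  "peak_aux_bits A \<I>1 \<I>2 xs = Max ((\<lambda>(aux, mem). aux_bits aux) ` configs A \<I>1 \<I>2 xs)"

text \<open>Every element of the ground set arrives exactly once per pass, in the same order each time.\<close>

definition stream_of :: "'a list \<Rightarrow> 'a set \<Rightarrow> bool" where
  "stream_of xs V \<longleftrightarrow> distinct xs \<and> set xs = V"

text \<open>
  The shift by 2 keeps the logarithm away from 0. The type argument only names the type of the
  ground elements.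
\<close>

definition semi_streaming :: "'a itself \<Rightarrow> stream_alg \<Rightarrow> bool" where
  "semi_streaming _ A \<longleftrightarrow>
     (\<exists>(c::real) (k::nat). \<forall>(V::'a set) \<I>1 \<I>2 xs.
        matroid V \<I>1 \<and> matroid V \<I>2 \<and> stream_of xs V \<longrightarrow>
        (let R = real (matroid_rank \<I>1 + matroid_rank \<I>2) in
           real (peak_elems A \<I>1 \<I>2 xs) \<le> c * R * log 2 (R + 2) ^ k))"

end

theory Submission
  imports Defs
begin

text \<open>
  The algorithm is an auction with prices 0, 1, 2. It maintains a common independent set \<open>S\<close> and a
  subset \<open>T\<close> of \<open>S\<close>; an element has price at least 1 if \<open>S\<close> spans it in the second matroid and price 2
  if \<open>T\<close> does. A greedy pass extends \<open>S\<close> to a maximal common independent set. A bidding pass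
  greedily collects a set \<open>F\<close> of new elements with \<open>S \<union> F\<close> independent in the first and \<open>T \<union> F\<close> in the
  second matroid; at its end \<open>T\<close> becomes \<open>T \<union> F\<close>, and \<open>S\<close> a set of the same size, independent in the
  second matroid, between \<open>T \<union> F\<close> and \<open>S \<union> F\<close>.

  After a greedy pass every element is spanned by \<open>S\<close> in the second matroid or by \<open>S - T\<close> in the
  first, so \<open>r \<le> 2 |S| - |T|\<close>. By maximality of \<open>F\<close>, every element is spanned by \<open>T \<union> F\<close> in the second
  matroid or by \<open>S \<union> F\<close> in the first, so \<open>r \<le> |S| + |T| + 2 |F|\<close>. Hence a bidding pass followed by
  a greedy pass yields \<open>2 r \<le> 3 |S| + |F|\<close>, and as \<open>|T|\<close> grows by \<open>|F|\<close> each time but never exceeds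
  \<open>r\<close>, summing over \<open>K\<close> such rounds gives \<open>2 K r \<le> 3 K |S| + r\<close>.
\<close>

section \<open>Spans and extensions in a single matroid\<close>

text \<open>For independent \<open>X\<close> this is the complement in the ground set of the span of
  \<open>X\<close>; being spanned is expressed as disjointness from it.\<close>

definition addable :: "'a set set \<Rightarrow> 'a set \<Rightarrow> 'a set" where
  "addable \<I> X = {e. e \<notin> X \<and> insert e X \<in> \<I>}"

context matroid
begin

lemma finite_indep: "X \<in> \<I> \<Longrightarrow> finite X"
  using finite_ground indep_subset_ground by (meson PowD finite_subset subsetD)

lemma finite_family: "finite \<I>"
  using finite_ground indep_subset_ground by (meson finite_Pow_iff finite_subset)

lemma empty_indep: "{} \<in> \<I>"
  using indep_nonempty indep_downward by blast

lemma card_le_rank: "X \<in> \<I> \<Longrightarrow> card X \<le> matroid_rank \<I>"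
  unfolding matroid_rank_def using finite_family by simp

lemma rank_le_card_ground: "matroid_rank \<I> \<le> card V"
  unfolding matroid_rank_def
  using finite_family indep_nonempty indep_subset_ground finite_ground
  by (auto intro!: card_mono)

lemma addable_antimono: "X \<subseteq> Y \<Longrightarrow> addable \<I> Y \<subseteq> addable \<I> X"
  unfolding addable_def using indep_downward by (blast intro: insert_mono)

lemma addable_ground: "addable \<I> X \<subseteq> V"
  unfolding addable_def using indep_subset_ground by auto

lemma extend_indep:
  assumes "X \<in> \<I>" "Y \<in> \<I>" "card X \<le> card Y"
  shows "\<exists>Z\<in>\<I>. X \<subseteq> Z \<and> Z \<subseteq> X \<union> Y \<and> card Z = card Y"
  using assms
proof (induction "card Y - card X" arbitrary: X)
  case 0
  then show ?case by auto
next
  case (Suc n)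
  then obtain y where y: "y \<in> Y - X" "insert y X \<in> \<I>"
    using indep_augment[of X Y] by fastforce
  have "card (insert y X) = Suc (card X)"
    using y finite_indep Suc.prems by simp
  then obtain Z where "Z \<in> \<I>" "insert y X \<subseteq> Z" "Z \<subseteq> insert y X \<union> Y" "card Z = card Y"
    using Suc.hyps(1)[of "insert y X"] Suc.hyps(2) Suc.prems y
    by (metis Suc_diff_Suc Suc_leI diff_Suc_Suc nat.inject zero_less_Suc zero_less_diff)
  then show ?case using y by blast
qed

text \<open>Were \<open>A\<close> larger, augmenting \<open>X\<close> from \<open>A\<close> would
  produce an addable element in \<open>A\<close>.\<close>

lemma card_le_if_spanned:
  assumes "A \<in> \<I>" "X \<in> \<I>" "A \<inter> addable \<I> X = {}"
  shows "card A \<le> card X"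
proof (rule ccontr)
  assume "\<not> card A \<le> card X"
  then obtain y where "y \<in> A - X" "insert y X \<in> \<I>"
    using assms indep_augment[of X A] by auto
  then show False using assms(3) by (auto simp: addable_def)
qed

text \<open>An element \<open>e\<close> addable to \<open>X\<close> but not to \<open>Y\<close>
  would make \<open>insert e X\<close> independent, spanned by \<open>Y\<close> and larger than
  \<open>Y\<close>. This lets a bidding pass exchange \<open>S\<close> without losing span in the
  second matroid.\<close>

lemma addable_if_spanned_card_eq:
  assumes X: "X \<in> \<I>" and Y: "Y \<in> \<I>" and "X \<inter> addable \<I> Y = {}" and "card X = card Y"
  shows "addable \<I> X \<subseteq> addable \<I> Y"
proof
  fix e assume e: "e \<in> addable \<I> X"
  show "e \<in> addable \<I> Y"
  proof (rule ccontr)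
    assume "e \<notin> addable \<I> Y"
    then have "card (insert e X) \<le> card Y"
      using e assms by (intro card_le_if_spanned) (auto simp: addable_def)
    then show False
      using e assms finite_indep by (auto simp: addable_def)
  qed
qed

text \<open>\<open>Q\<close> is independent modulo the span of \<open>Z\<close>, hence modulo
  anything inside that span. Concretely, extend \<open>W\<close> within
  \<open>W \<union> Z \<union> Q\<close> to the size of \<open>Z \<union> Q\<close>: the part
  outside \<open>Q\<close> is spanned by \<open>Z\<close>, so it has at most \<open>card Z\<close>
  elements, and all of \<open>Q\<close> must be present.\<close>

lemma indep_Un_skew:
  assumes ZQ: "Z \<union> Q \<in> \<I>" "Z \<inter> Q = {}" and W: "W \<in> \<I>" "W \<inter> addable \<I> Z = {}"
  shows "W \<union> Q \<in> \<I>"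
proof -
  have Z: "Z \<in> \<I>" and fin: "finite Z" "finite Q"
    using ZQ(1) indep_downward finite_indep by (blast, auto)
  have "card W \<le> card Z" using card_le_if_spanned W Z by simp
  also have "\<dots> \<le> card (Z \<union> Q)" using fin by (intro card_mono) auto
  finally obtain Y where Y: "Y \<in> \<I>" "W \<subseteq> Y" "Y \<subseteq> W \<union> (Z \<union> Q)" "card Y = card (Z \<union> Q)"
    using extend_indep W ZQ by blast
  have "(Y - Q) \<inter> addable \<I> Z = {}"
    using Y(3) W(2) by (auto simp: addable_def)
  then have "card (Y - Q) \<le> card Z"
    using Y(1) Z indep_downward by (intro card_le_if_spanned) auto
  moreover have "card Y = card (Y - Q) + card (Y \<inter> Q)"
    using Y(1) finite_indep by (metis add.commute card_Int_Diff)
  moreover have "card (Z \<union> Q) = card Z + card Q"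
    using fin ZQ(2) by (simp add: card_Un_disjoint)
  ultimately have "card Q \<le> card (Y \<inter> Q)" using Y(4) by simp
  then have "Q \<subseteq> Y"
    using fin by (metis Int_lower1 Int_lower2 card_subset_eq card_mono le_antisym)
  then show ?thesis using Y(2) by (intro indep_downward[OF Y(1)]) simp
qed

end

section \<open>The auction as an algorithm on positions\<close>

text \<open>\<open>J\<close> holds the stored positions that enter the test in the second matroid;
  the first matroid always tests all of them. The comparison with stored elements prevents
  duplicates, since every pass meets these elements again.\<close>

definition admit :: "nat set \<Rightarrow> oracle_view \<Rightarrow> nat list" where
  "admit J v = (let m = num_avail v - 1 in
     if (\<forall>i<m. \<not> same_elem v i m) \<and> indep1 v {..m} \<and> indep2 v (insert m J)
     then [0..<Suc m] else [0..<m])"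

text \<open>
  The memory is a list of the elements of \<open>T\<close>, followed by those
  of \<open>S - T\<close>, followed in a bidding pass by those of \<open>F\<close>. The auxiliary data is \<open>[card T]\<close> in a greedy
  pass and \<open>[card T, card S]\<close> in a bidding pass.
\<close>

fun arrive :: "nat list \<Rightarrow> oracle_view \<Rightarrow> nat list \<times> nat list" where
  "arrive [t] v = ([t], admit {..<num_avail v - 1} v)"
| "arrive [t, s] v = ([t, s], admit ({..<t} \<union> {s..<num_avail v - 1}) v)"
| "arrive aux v = (aux, [])"

text \<open>Selects from the old \<open>S - T\<close> what completes \<open>T \<union> F\<close> to
  the size of \<open>S\<close>. The choice depends on the view alone; a candidate is exhibited in
  the proof of \<open>bidding_pass\<close>.\<close>

definition refill :: "nat \<Rightarrow> nat \<Rightarrow> oracle_view \<Rightarrow> nat list" where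
  "refill t s v = (SOME rs. distinct rs \<and> set rs \<subseteq> {t..<s} \<and>
     t + (num_avail v - s) + length rs = s \<and>
     indep2 v ({..<t} \<union> {s..<num_avail v} \<union> set rs))"

text \<open>The length of the auxiliary list encodes the phase, so each clause switches it. After
  bidding, \<open>T \<union> F\<close> moves to the front, where the next pass expects its
  \<open>T\<close>.\<close>

fun finish_pass :: "nat list \<Rightarrow> oracle_view \<Rightarrow> nat list \<times> nat list" where
  "finish_pass [t] v = ([t, num_avail v], [0..<num_avail v])"
| "finish_pass [t, s] v =
     ([t + (num_avail v - s)], [0..<t] @ [s..<num_avail v] @ refill t s v)"
| "finish_pass aux v = (aux, [])"

text \<open>One greedy pass, then \<open>K\<close> rounds of a bidding and a greedy pass. The run
  ends with a greedy pass, so the whole memory is the answer.\<close>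

definition auction :: "nat \<Rightarrow> stream_alg" where
  "auction K = \<lparr> init_aux = [0], on_arrival = arrive, on_pass_end = finish_pass,
     num_passes = 2 * K + 1, final_choice = (\<lambda>_ _. UNIV) \<rparr>"

section \<open>From positions to elements\<close>

lemma nth_image_lessThan: "t \<le> length xs \<Longrightarrow> (!) xs ` {..<t} = set (take t xs)"
  by (simp add: nth_image flip: atLeast0LessThan)

lemma nth_image_from: "(!) xs ` {s..<length xs} = set (drop s xs)"
proof -
  have "set (drop s xs) = (!) (drop s xs) ` {0..<length xs - s}"
    using nth_image[of "length xs - s" "drop s xs"] by simp
  also have "\<dots> = (\<lambda>i. xs ! (s + i)) ` {0..<length xs - s}"
    by (intro image_cong) auto
  also have "\<dots> = (!) xs ` (+) s ` {0..<length xs - s}" by (simp only: image_image)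
  also have "(+) s ` {0..<length xs - s} = {s..<length xs}"
    by (cases "s \<le> length xs") (simp_all only: image_add_atLeastLessThan, simp_all)
  finally show ?thesis by simp
qed

lemma keep_eq_map: "set is \<subseteq> {..<length es} \<Longrightarrow> keep es is = map ((!) es) is"
  unfolding keep_def by (subst filter_True) auto

lemma map_nth_upt: "n \<le> length xs \<Longrightarrow> map ((!) xs) [m..<n] = drop m (take n xs)"
  by (rule nth_equalityI) auto

lemma keep_all: "keep es [0..<length es] = es"
  by (subst keep_eq_map) (auto simp: map_nth_upt)

text \<open>Translates the test on positions into one on elements, so that the analysis of arrivals
  can speak of sets.\<close>

lemma keep_admit:
  assumes J: "J \<subseteq> {..<length mem}"
  shows "keep (mem @ [e]) (admit J (view_of \<I>1 \<I>2 (mem @ [e]))) =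
    (if e \<notin> set mem \<and> insert e (set mem) \<in> \<I>1 \<and> insert e ((!) mem ` J) \<in> \<I>2
     then mem @ [e] else mem)"
proof -
  let ?es = "mem @ [e]"
  have 1: "(!) ?es ` {..length mem} = insert e (set mem)"
    using nth_image_lessThan[of "Suc (length mem)" ?es] by (simp add: lessThan_Suc_atMost)
  have 2: "(!) ?es ` insert (length mem) J = insert e ((!) mem ` J)"
    using J by (auto simp: nth_append image_def)
  have 3: "(\<forall>i<length mem. ?es ! i \<noteq> e) \<longleftrightarrow> e \<notin> set mem"
    by (auto simp: nth_append in_set_conv_nth)
  have 4: "{..length mem} \<subseteq> {..<length ?es}" "insert (length mem) J \<subseteq> {..<length ?es}"
    using J by auto
  have 5: "keep ?es [0..<Suc (length mem)] = ?es" "keep ?es [0..<length mem] = mem"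
    by (subst keep_eq_map; auto simp: map_nth_upt simp del: upt_Suc)+
  have 6: "(\<forall>i<length mem. \<not> same_elem (view_of \<I>1 \<I>2 ?es) i (length mem)) \<longleftrightarrow> e \<notin> set mem"
    using 3 by (auto simp: view_of_def)
  have 7: "indep1 (view_of \<I>1 \<I>2 ?es) {..length mem} \<longleftrightarrow> insert e (set mem) \<in> \<I>1"
    "indep2 (view_of \<I>1 \<I>2 ?es) (insert (length mem) J) \<longleftrightarrow> insert e ((!) mem ` J) \<in> \<I>2"
    using 1 2 4 by (simp_all add: view_of_def)
  have 8: "num_avail (view_of \<I>1 \<I>2 ?es) - 1 = length mem" by (simp add: view_of_def)
  show ?thesis unfolding admit_def Let_def 8 6 7 using 5 by (simp del: upt_Suc)
qed

lemma arrival_step_greedy: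
  "arrival_step (auction K) \<I>1 \<I>2 e ([t], mem) = ([t],
     if e \<notin> set mem \<and> insert e (set mem) \<in> \<I>1 \<and> insert e (set mem) \<in> \<I>2
     then mem @ [e] else mem)"
  using keep_admit[of "{..<length mem}" mem e \<I>1 \<I>2]
  by (simp add: arrival_step_def auction_def Let_def view_of_def nth_image_lessThan)

lemma arrival_step_bidding:
  assumes "t \<le> length S" "s = length S"
  shows "arrival_step (auction K) \<I>1 \<I>2 e ([t, s], S @ F) = ([t, s],
     if e \<notin> set (S @ F) \<and> insert e (set (S @ F)) \<in> \<I>1 \<and> insert e (set (take t S) \<union> set F) \<in> \<I>2
     then (S @ F) @ [e] else S @ F)"
proof -
  have "(!) (S @ F) ` ({..<t} \<union> {s..<length (S @ F)}) = set (take t S) \<union> set F"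
    using assms by (simp only: image_Un nth_image_from) (simp add: nth_image_lessThan)
  moreover have "{..<t} \<union> {s..<length (S @ F)} \<subseteq> {..<length (S @ F)}"
    using assms by auto
  ultimately show ?thesis
    using keep_admit[of "{..<t} \<union> {s..<length (S @ F)}" "S @ F" e \<I>1 \<I>2] assms
    by (simp add: arrival_step_def auction_def Let_def view_of_def ivl_subset del: append_assoc)
qed

section \<open>Greedy collection during a single pass\<close>

locale two_matroids = M1: matroid V \<I>1 + M2: matroid V \<I>2
  for V :: "'a set" and \<I>1 \<I>2
begin

text \<open>Serves both kinds of pass: \<open>X\<close> is \<open>set mem\<close> in a greedy pass
  and \<open>T\<close> in a bidding pass. A rejected element stays rejected because
  \<open>addable\<close> shrinks as the sets grow, which gives maximality with respect to all of
  \<open>ys\<close>.\<close>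

lemma greedy_fold:
  assumes step: "\<And>e bs. f e (aux, mem @ bs) = (aux,
      if e \<notin> set (mem @ bs) \<and> insert e (set (mem @ bs)) \<in> \<I>1 \<and> insert e (X \<union> set bs) \<in> \<I>2
      then (mem @ bs) @ [e] else mem @ bs)"
    and "distinct mem" "set mem \<in> \<I>1" "X \<in> \<I>2"
  shows "\<exists>bs. fold f ys (aux, mem) = (aux, mem @ bs) \<and> distinct (mem @ bs) \<and>
    set (mem @ bs) \<in> \<I>1 \<and> X \<union> set bs \<in> \<I>2 \<and>
    set ys \<inter> addable \<I>1 (set (mem @ bs)) \<inter> addable \<I>2 (X \<union> set bs) = {}"
proof (induction ys rule: rev_induct)
  case Nil
  show ?case using assms by (intro exI[of _ "[]"]) auto
next
  case (snoc e ys)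
  then obtain bs where bs: "fold f ys (aux, mem) = (aux, mem @ bs)" "distinct (mem @ bs)"
    "set (mem @ bs) \<in> \<I>1" "X \<union> set bs \<in> \<I>2"
    "set ys \<inter> addable \<I>1 (set (mem @ bs)) \<inter> addable \<I>2 (X \<union> set bs) = {}" by blast
  show ?case
  proof (cases "e \<notin> set (mem @ bs) \<and> insert e (set (mem @ bs)) \<in> \<I>1 \<and> insert e (X \<union> set bs) \<in> \<I>2")
    case True
    have "addable \<I>1 (set (mem @ bs @ [e])) \<subseteq> addable \<I>1 (set (mem @ bs))"
      "addable \<I>2 (X \<union> set (bs @ [e])) \<subseteq> addable \<I>2 (X \<union> set bs)"
      by (auto intro!: M1.addable_antimono M2.addable_antimono)
    moreover have "e \<notin> addable \<I>1 (set (mem @ bs @ [e]))" by (simp add: addable_def)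
    ultimately show ?thesis
      using bs True step[of e bs] by (intro exI[of _ "bs @ [e]"]) auto
  next
    case False
    then have "e \<notin> addable \<I>1 (set (mem @ bs)) \<inter> addable \<I>2 (X \<union> set bs)"
      by (auto simp: addable_def)
    then show ?thesis
      using bs False step[of e bs] by (intro exI[of _ bs]) auto
  qed
qed

lemma greedy_arrivals:
  assumes "distinct mem" "set mem \<in> \<I>1 \<inter> \<I>2"
  obtains bs where "fold (arrival_step (auction K) \<I>1 \<I>2) ys ([t], mem) = ([t], mem @ bs)"
    "distinct (mem @ bs)" "set (mem @ bs) \<in> \<I>1 \<inter> \<I>2"
    "set ys \<inter> addable \<I>1 (set (mem @ bs)) \<inter> addable \<I>2 (set (mem @ bs)) = {}"
proof -
  have "\<exists>bs. fold (arrival_step (auction K) \<I>1 \<I>2) ys ([t], mem) = ([t], mem @ bs) \<and>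
    distinct (mem @ bs) \<and> set (mem @ bs) \<in> \<I>1 \<and> set mem \<union> set bs \<in> \<I>2 \<and>
    set ys \<inter> addable \<I>1 (set (mem @ bs)) \<inter> addable \<I>2 (set mem \<union> set bs) = {}"
    using assms by (intro greedy_fold) (simp_all add: arrival_step_greedy del: append_assoc)
  then obtain bs where bs: "fold (arrival_step (auction K) \<I>1 \<I>2) ys ([t], mem) = ([t], mem @ bs)"
    "distinct (mem @ bs)" "set (mem @ bs) \<in> \<I>1" "set mem \<union> set bs \<in> \<I>2"
    "set ys \<inter> addable \<I>1 (set (mem @ bs)) \<inter> addable \<I>2 (set mem \<union> set bs) = {}"
    by (elim exE conjE)
  have "set (mem @ bs) \<in> \<I>1 \<inter> \<I>2" using bs(3,4) by simp
  moreover have "set ys \<inter> addable \<I>1 (set (mem @ bs)) \<inter> addable \<I>2 (set (mem @ bs)) = {}"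
    using bs(5) by (simp only: set_append)
  ultimately show thesis by (rule that[OF bs(1,2)])
qed

lemma bidding_arrivals:
  assumes "distinct S" "set S \<in> \<I>1 \<inter> \<I>2" "t \<le> length S"
  obtains F where
    "fold (arrival_step (auction K) \<I>1 \<I>2) ys ([t, length S], S) = ([t, length S], S @ F)"
    "distinct (S @ F)" "set (S @ F) \<in> \<I>1" "set (take t S) \<union> set F \<in> \<I>2"
    "set ys \<inter> addable \<I>1 (set (S @ F)) \<inter> addable \<I>2 (set (take t S) \<union> set F) = {}"
proof -
  have "set (take t S) \<in> \<I>2"
    using assms(2) by (intro M2.indep_downward[OF _ set_take_subset]) blast
  then have "\<exists>F. fold (arrival_step (auction K) \<I>1 \<I>2) ys ([t, length S], S) = ([t, length S], S @ F) \<and>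
    distinct (S @ F) \<and> set (S @ F) \<in> \<I>1 \<and> set (take t S) \<union> set F \<in> \<I>2 \<and>
    set ys \<inter> addable \<I>1 (set (S @ F)) \<inter> addable \<I>2 (set (take t S) \<union> set F) = {}"
    using assms by (intro greedy_fold) (simp_all add: arrival_step_bidding del: append_assoc)
  then show thesis by (elim exE conjE) (rule that)
qed

section \<open>Bounds on the optimum and invariants between passes\<close>

definition opt :: nat where "opt = max_common \<I>1 \<I>2"

lemma card_le_opt: "X \<in> \<I>1 \<inter> \<I>2 \<Longrightarrow> card X \<le> opt"
  unfolding opt_def max_common_def using M1.finite_family by simp

lemma opt_attained: "\<exists>X \<in> \<I>1 \<inter> \<I>2. card X = opt"
proof -
  have "opt \<in> card ` (\<I>1 \<inter> \<I>2)"
    unfolding opt_def max_common_def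
    using M1.finite_family M1.empty_indep M2.empty_indep by (intro Max_in) auto
  then show ?thesis by auto
qed

text \<open>The easy half of the matroid intersection min-max relation: a maximum common independent
  set splits into a part spanned by \<open>X\<close> in the first matroid and a part spanned by
  \<open>Y\<close> in the second.\<close>

lemma opt_le:
  assumes "X \<in> \<I>1" "Y \<in> \<I>2" "addable \<I>1 X \<inter> addable \<I>2 Y = {}"
  shows "opt \<le> card X + card Y"
proof -
  obtain A where A: "A \<in> \<I>1 \<inter> \<I>2" "card A = opt" using opt_attained by blast
  have "card (A - addable \<I>1 X) \<le> card X"
    using A assms M1.indep_downward by (intro M1.card_le_if_spanned) auto
  moreover have "card (A \<inter> addable \<I>1 X) \<le> card Y"
    using A assms M2.indep_downward by (intro M2.card_le_if_spanned) auto
  moreover have "card A = card (A \<inter> addable \<I>1 X) + card (A - addable \<I>1 X)"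
    using A M1.finite_indep by (intro card_Int_Diff) auto
  ultimately show ?thesis using A by simp
qed

text \<open>
  The set \<open>Z\<close> is the \<open>S - T\<close> of the preceding greedy pass, or a base of the first matroid before
  the first pass. It serves to show that the greedy pass
  that comes next again ends with every element spanned by \<open>S\<close> in the second matroid or by \<open>S - T\<close>
  in the first.
\<close>

definition greedy_start :: "nat \<Rightarrow> 'a config \<Rightarrow> bool" where
  "greedy_start i c \<longleftrightarrow> (\<exists>t mem Z. c = ([t], mem) \<and> t \<le> length mem \<and> distinct mem \<and>
     set mem \<in> \<I>1 \<inter> \<I>2 \<and> Z \<union> set (take t mem) \<in> \<I>1 \<and> Z \<inter> set (take t mem) = {} \<and>
     set (drop t mem) \<subseteq> Z \<and> addable \<I>1 Z \<inter> addable \<I>2 (set mem) = {} \<and>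
     (i = 0 \<or> 2 * i * opt + 2 * length mem \<le> opt + 3 * i * length mem + 2 * t))"

text \<open>The last clause sums the bounds of \<open>i\<close> rounds: the sizes of
  \<open>F\<close> add up to \<open>t\<close>, and earlier sizes of \<open>S\<close> are replaced by
  the current one, which is at least as large.\<close>

definition bidding_start :: "nat \<Rightarrow> 'a config \<Rightarrow> bool" where
  "bidding_start i c \<longleftrightarrow> (\<exists>t mem. c = ([t, length mem], mem) \<and> t \<le> length mem \<and> distinct mem \<and>
     set mem \<in> \<I>1 \<inter> \<I>2 \<and> addable \<I>1 (set (drop t mem)) \<inter> addable \<I>2 (set mem) = {} \<and>
     2 * i * opt \<le> 3 * i * length mem + t)"

lemma greedy_start_init: "greedy_start 0 ([0], [])"
proof -
  have "matroid_rank \<I>1 \<in> card ` \<I>1"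
    unfolding matroid_rank_def using M1.finite_family M1.indep_nonempty by (intro Max_in) auto
  then obtain B where B: "B \<in> \<I>1" "card B = matroid_rank \<I>1" by auto
  have "addable \<I>1 B = {}"
  proof (rule ccontr)
    assume "addable \<I>1 B \<noteq> {}"
    then obtain e where "e \<notin> B" "insert e B \<in> \<I>1" by (auto simp: addable_def)
    then show False using B M1.card_le_rank[of "insert e B"] M1.finite_indep by simp
  qed
  then show ?thesis
    unfolding greedy_start_def using B M1.empty_indep M2.empty_indep
    by (intro exI[of _ 0] exI[of _ "[]"] exI[of _ B]) simp
qed

text \<open>Maximality alone only speaks of \<open>S\<close> in both matroids; passing to
  \<open>S - T\<close> in the first one rests on \<open>Z\<close> and \<open>T\<close> being
  skew.\<close>

lemma greedy_pass:
  assumes "greedy_start i c" "set xs = V"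
  shows "bidding_start i (run_pass (auction K) \<I>1 \<I>2 xs c)"
proof -
  obtain t mem Z where c: "c = ([t], mem)" and tm: "t \<le> length mem" "distinct mem"
    and mem: "set mem \<in> \<I>1 \<inter> \<I>2"
    and Z: "Z \<union> set (take t mem) \<in> \<I>1" "Z \<inter> set (take t mem) = {}" "set (drop t mem) \<subseteq> Z"
      "addable \<I>1 Z \<inter> addable \<I>2 (set mem) = {}"
    and pot: "i = 0 \<or> 2 * i * opt + 2 * length mem \<le> opt + 3 * i * length mem + 2 * t"
    using assms unfolding greedy_start_def by blast
  obtain bs where fold: "fold (arrival_step (auction K) \<I>1 \<I>2) xs ([t], mem) = ([t], mem @ bs)"
    and bs: "distinct (mem @ bs)" "set (mem @ bs) \<in> \<I>1 \<inter> \<I>2"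
    and mx: "set xs \<inter> addable \<I>1 (set (mem @ bs)) \<inter> addable \<I>2 (set (mem @ bs)) = {}"
    using greedy_arrivals[OF tm(2) mem] by blast
  let ?S = "mem @ bs"
  have mx': "addable \<I>1 (set ?S) \<inter> addable \<I>2 (set ?S) = {}"
    using mx assms(2) M1.addable_ground by blast
  have run: "run_pass (auction K) \<I>1 \<I>2 xs c = ([t, length ?S], ?S)"
    using fold keep_all[of ?S] unfolding c run_pass_def
    by (simp add: pass_end_step_def auction_def view_of_def)
  \<comment> \<open>Each new element is addable to the old \<open>mem\<close> in the second matroid,
    so \<open>Z\<close> spans it in the first.\<close>
  have bsZ: "set bs \<inter> addable \<I>1 Z = {}"
  proof -
    have "set bs \<subseteq> addable \<I>2 (set mem)"
      using bs by (auto simp: addable_def intro: M2.indep_downward)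
    then show ?thesis using Z(4) by blast
  qed
  \<comment> \<open>For a counterexample \<open>e\<close>, the set \<open>S - T\<close> with
    \<open>e\<close> added is spanned by \<open>Z\<close> in the first matroid. By skewness
    \<open>T\<close> can be joined to it, so \<open>e\<close> is addable to \<open>S\<close> in both
    matroids, against maximality.\<close>
  have key: "addable \<I>1 (set (drop t ?S)) \<inter> addable \<I>2 (set ?S) = {}"
  proof (rule ccontr)
    assume "addable \<I>1 (set (drop t ?S)) \<inter> addable \<I>2 (set ?S) \<noteq> {}"
    then obtain e where e1: "e \<in> addable \<I>1 (set (drop t ?S))" and e2: "e \<in> addable \<I>2 (set ?S)" by blast
    have "e \<notin> addable \<I>1 Z"
      using e2 M2.addable_antimono[of "set mem" "set ?S"] Z(4) by auto
    then have "insert e (set (drop t ?S)) \<union> set (take t mem) \<in> \<I>1"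
      using e1 bsZ Z(3) tm(1) by (intro M1.indep_Un_skew[OF Z(1,2)]) (auto simp: addable_def)
    moreover have "set (drop t ?S) \<union> set (take t mem) = set ?S"
      using tm(1) by simp (metis Un_assoc Un_commute append_take_drop_id set_append)
    ultimately have "e \<in> addable \<I>1 (set ?S)"
      using e2 by (simp add: addable_def)
    then show False using e2 mx' by blast
  qed
  have "set (drop t ?S) \<in> \<I>1"
    using bs(2) by (intro M1.indep_downward[OF _ set_drop_subset]) blast
  then have "opt \<le> card (set (drop t ?S)) + card (set ?S)"
    using key bs(2) by (intro opt_le) auto
  moreover have "card (set (drop t ?S)) = length ?S - t" "card (set ?S) = length ?S"
    using distinct_card[OF bs(1)] distinct_card[OF distinct_drop[OF bs(1)], of t]
    by (simp_all only: length_drop)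
  ultimately have *: "opt + t \<le> 2 * length ?S" using tm(1) by simp
  have "2 * i * opt \<le> 3 * i * length ?S + t"
  \<comment> \<open>For \<open>i = Suc j\<close>, moving \<open>2 * length mem\<close> to the right
    leaves it the coefficient \<open>3 * j + 1\<close>, which is nonnegative, so the larger length
    of \<open>?S\<close> may replace \<open>length mem\<close>. For \<open>i = 0\<close> the claim
    is trivial.\<close>
  proof (cases i)
    case (Suc j)
    have "3 * j * length mem \<le> 3 * j * length ?S" by simp
    then show ?thesis using pot * Suc by (simp add: algebra_simps)
  qed simp
  moreover have "t \<le> length ?S" using tm(1) by simp
  ultimately show ?thesis
    unfolding bidding_start_def run using bs key
    by (intro exI[where x = t] exI[where x = ?S] conjI refl)
qed

text \<open>The old \<open>S - T\<close> becomes the new \<open>Z\<close>: with the new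
  \<open>T\<close>, which is \<open>T \<union> F\<close>, it makes up \<open>S \<union> F\<close>.
  The new \<open>S\<close> lies in the second-matroid span of the old one and has the same size, so
  it spans no less.\<close>

lemma bidding_pass:
  assumes "bidding_start i c" "set xs = V"
  shows "greedy_start (Suc i) (run_pass (auction K) \<I>1 \<I>2 xs c)"
proof -
  obtain t S where c: "c = ([t, length S], S)" and t: "t \<le> length S" and dS: "distinct S"
    and S: "set S \<in> \<I>1 \<inter> \<I>2"
    and key: "addable \<I>1 (set (drop t S)) \<inter> addable \<I>2 (set S) = {}"
    and pot: "2 * i * opt \<le> 3 * i * length S + t"
    using assms unfolding bidding_start_def by blast
  obtain F where fold: "fold (arrival_step (auction K) \<I>1 \<I>2) xs ([t, length S], S) = ([t, length S], S @ F)"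
    and dF: "distinct (S @ F)" and F: "set (S @ F) \<in> \<I>1" "set (take t S) \<union> set F \<in> \<I>2"
    and mx: "set xs \<inter> addable \<I>1 (set (S @ F)) \<inter> addable \<I>2 (set (take t S) \<union> set F) = {}"
    using bidding_arrivals[OF dS S t] by blast
  let ?TF = "set (take t S) \<union> set F" and ?v = "view_of \<I>1 \<I>2 (S @ F)"
  have mx': "addable \<I>1 (set (S @ F)) \<inter> addable \<I>2 ?TF = {}"
    using mx assms(2) M1.addable_ground by blast
  have cardS: "card (set S) = length S" using dS by (simp add: distinct_card)
  \<comment> \<open>As \<open>S \<union> F\<close> is independent in the first matroid,
    \<open>F\<close> avoids the span of \<open>S - T\<close> there; by \<open>key\<close>,
    \<open>S\<close> spans \<open>F\<close> in the second. Hence \<open>T \<union> F\<close> is no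
    larger than \<open>S\<close> and can be extended from it.\<close>
  have "set F \<subseteq> addable \<I>1 (set (drop t S))"
    using dF F(1) by (auto simp: addable_def dest: in_set_dropD intro: M1.indep_downward)
  then have spanF: "?TF \<inter> addable \<I>2 (set S) = {}"
    using key set_take_subset[of t S] by (auto simp: addable_def)
  then have TF_le: "card ?TF \<le> card (set S)"
    using F(2) S by (intro M2.card_le_if_spanned) auto
  have cardTF: "card ?TF = t + length F"
  proof -
    have "set (take t S) \<inter> set F = {}" using dF set_take_subset[of t S] by auto
    then have "card ?TF = card (set (take t S)) + card (set F)" by (simp add: card_Un_disjoint)
    then show ?thesis using dF t distinct_card[of "take t S"] distinct_card[of F] by simp
  qed
  obtain Y where Y: "Y \<in> \<I>2" "?TF \<subseteq> Y" "Y \<subseteq> ?TF \<union> set S" "card Y = length S"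
    using M2.extend_indep[OF F(2), of "set S"] S TF_le cardS by auto
  have img: "(!) (S @ F) ` ({..<t} \<union> {length S..<length (S @ F)} \<union> R) = ?TF \<union> (!) S ` R"
    if "R \<subseteq> {t..<length S}" for R
  proof -
    have "(!) (S @ F) ` R = (!) S ` R"
      using that by (intro image_cong) (auto simp: nth_append)
    then show ?thesis
      unfolding image_Un nth_image_from using t nth_image_lessThan[of t "S @ F"] by simp
  qed
  let ?P = "\<lambda>rs. distinct rs \<and> set rs \<subseteq> {t..<length S} \<and>
     t + (num_avail ?v - length S) + length rs = length S \<and>
     indep2 ?v ({..<t} \<union> {length S..<num_avail ?v} \<union> set rs)"
  have "\<exists>rs. ?P rs"
  proof -
    \<comment> \<open>The surviving positions are read off from the extension \<open>Y\<close> of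
      \<open>T \<union> F\<close> inside \<open>T \<union> F \<union> S\<close>.\<close>
    define R where "R = {j \<in> {t..<length S}. S ! j \<in> Y}"
    have R: "R \<subseteq> {t..<length S}" "finite R" by (auto simp: R_def)
    obtain rs where rs: "set rs = R" "distinct rs" using finite_distinct_list R(2) by blast
    have "set S = set (take t S) \<union> (!) S ` {t..<length S}"
      by (simp add: nth_image_from flip: set_append)
    then have YR: "Y = ?TF \<union> (!) S ` R"
      using Y(2,3) by (auto simp: R_def)
    have inj: "inj_on ((!) S) R"
      using dS R(1) by (intro inj_on_nth) auto
    have "?TF \<inter> (!) S ` R = {}"
    proof -
      have "set (take t S) \<inter> (!) S ` {t..<length S} = {}"
        using dS by (simp add: nth_image_from set_take_disj_set_drop_if_distinct)
      moreover have "set F \<inter> set S = {}" using dF by auto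
      moreover have "(!) S ` R \<subseteq> set S" using R(1) by auto
      ultimately show ?thesis using R(1) by blast
    qed
    then have "card Y = t + length F + length rs"
      using YR cardTF inj R(2) rs by (simp add: card_Un_disjoint card_image distinct_card[symmetric])
    moreover have "({..<t} \<union> {length S..<length (S @ F)} \<union> R) \<subseteq> {..<length (S @ F)}"
      using t R(1) by auto
    ultimately have "?P rs"
      using rs R Y YR img[OF R(1)] by (simp add: view_of_def)
    then show ?thesis by blast
  qed
  then have P: "?P (refill t (length S) ?v)"
    unfolding refill_def by (rule someI_ex)
  define rs where "rs = refill t (length S) ?v"
  have rs: "distinct rs" "set rs \<subseteq> {t..<length S}" "t + length F + length rs = length S"
    "?TF \<union> (!) S ` set rs \<in> \<I>2"
    using P img[of "set rs"] by (auto simp: rs_def view_of_def)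
  let ?mem = "take t S @ F @ map ((!) S) rs" and ?t = "t + length F"
  have run: "run_pass (auction K) \<I>1 \<I>2 xs c = ([?t], ?mem)"
  proof -
    have "map ((!) (S @ F)) rs = map ((!) S) rs"
      using rs(2) by (auto simp: nth_append)
    moreover have "set ([0..<t] @ [length S..<length (S @ F)] @ rs) \<subseteq> {..<length (S @ F)}"
      using t rs(2) by auto
    ultimately have "keep (S @ F) ([0..<t] @ [length S..<length (S @ F)] @ rs) = ?mem"
      using t by (simp add: keep_eq_map map_nth_upt)
    then show ?thesis
      using fold unfolding c run_pass_def
      by (simp add: pass_end_step_def auction_def rs_def) (simp add: view_of_def)
  qed
  have rsS: "(!) S ` set rs \<subseteq> set (drop t S)"
    using rs(2) nth_image_from[of S t] by blast
  have len: "length ?mem = length S" "take ?t ?mem = take t S @ F" "drop ?t ?mem = map ((!) S) rs"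
    using rs(3) t by simp_all
  have set_mem: "set ?mem = ?TF \<union> (!) S ` set rs" by auto
  have disj: "set (drop t S) \<inter> ?TF = {}"
    using dF set_drop_subset[of t S] set_take_disj_set_drop_if_distinct[of S t t] by auto
  have "distinct (map ((!) S) rs)"
    using rs(1,2) dS unfolding distinct_map by (intro conjI inj_on_nth) auto
  then have dist: "distinct ?mem"
    using dF rsS disj set_take_subset[of t S] by auto
  have sub: "set (drop t S) \<union> ?TF = set (S @ F)"
    by (metis Un_assoc Un_commute append_take_drop_id set_append)
  have indep: "set ?mem \<in> \<I>1 \<inter> \<I>2"
    using rs(4) rsS sub F(1) unfolding set_mem by (auto intro: M1.indep_downward)
  have "set ?mem \<inter> addable \<I>2 (set S) = {}"
    using spanF rsS set_drop_subset[of t S] unfolding set_mem by (auto simp: addable_def)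
  then have "addable \<I>2 (set ?mem) \<subseteq> addable \<I>2 (set S)"
    using indep S dist len(1) cardS distinct_card[of ?mem]
    by (intro M2.addable_if_spanned_card_eq) auto
  then have key': "addable \<I>1 (set (drop t S)) \<inter> addable \<I>2 (set ?mem) = {}"
    using key by blast
  have "opt \<le> card (set (S @ F)) + card ?TF"
    using F mx' by (intro opt_le) auto
  then have "opt \<le> length S + t + 2 * length F"
    using cardTF distinct_card[OF dF] by simp
  \<comment> \<open>Adds the invariant of \<open>i\<close> rounds to the bound from maximality of
    \<open>F\<close>; the remaining \<open>opt\<close> on the right is paid for by the next greedy
    pass.\<close>
  then have "2 * Suc i * opt + 2 * length ?mem \<le> opt + 3 * Suc i * length ?mem + 2 * ?t"
    using pot unfolding len(1) by (simp add: algebra_simps)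
  moreover have "set (drop t S) \<union> set (take ?t ?mem) \<in> \<I>1"
    using F(1) sub unfolding len(2) by simp
  moreover have "set (drop t S) \<inter> set (take ?t ?mem) = {}"
    using disj unfolding len(2) by simp
  moreover have "set (drop ?t ?mem) \<subseteq> set (drop t S)"
    using rsS unfolding len(3) by simp
  moreover have "?t \<le> length ?mem" using t by simp
  ultimately show ?thesis
    unfolding greedy_start_def run using dist indep key' by blast
qed

section \<open>The sequence of passes, its memory and its output\<close>

lemma after_passes_Suc:
  "after_passes A \<I>1 \<I>2 xs (Suc p) = run_pass A \<I>1 \<I>2 xs (after_passes A \<I>1 \<I>2 xs p)"
  by (simp add: after_passes_def)

lemma after_passes_auction:
  assumes "set xs = V"
  shows "greedy_start i (after_passes (auction K) \<I>1 \<I>2 xs (2 * i))"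
    and "bidding_start i (after_passes (auction K) \<I>1 \<I>2 xs (Suc (2 * i)))"
proof (induction i)
  case 0
  show 1: "greedy_start 0 (after_passes (auction K) \<I>1 \<I>2 xs (2 * 0))"
    using greedy_start_init by (simp add: after_passes_def auction_def)
  show "bidding_start 0 (after_passes (auction K) \<I>1 \<I>2 xs (Suc (2 * 0)))"
    using greedy_pass[OF 1 assms] by (simp only: after_passes_Suc)
next
  case (Suc i)
  show 1: "greedy_start (Suc i) (after_passes (auction K) \<I>1 \<I>2 xs (2 * Suc i))"
    using bidding_pass[OF Suc(2) assms] by (simp add: after_passes_Suc)
  show "bidding_start (Suc i) (after_passes (auction K) \<I>1 \<I>2 xs (Suc (2 * Suc i)))"
    using greedy_pass[OF 1 assms] by (simp only: after_passes_Suc)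
qed

text \<open>Even while bidding, the stored set is independent in the first matroid, so its rank
  bounds the memory and both counters.\<close>

definition small_config :: "'a config \<Rightarrow> bool" where
  "small_config c \<longleftrightarrow> length (snd c) \<le> matroid_rank \<I>1 \<and>
     (\<exists>t s. (fst c = [t] \<or> fst c = [t, s]) \<and> t \<le> matroid_rank \<I>1 \<and> s \<le> matroid_rank \<I>1)"

lemma length_le_rank: "distinct L \<Longrightarrow> set L \<in> \<I>1 \<Longrightarrow> length L \<le> matroid_rank \<I>1"
  using M1.card_le_rank distinct_card by metis

lemma small_config_greedy:
  assumes "greedy_start i c"
  shows "small_config (fold (arrival_step (auction K) \<I>1 \<I>2) ys c)"
proof -
  obtain t mem where c: "c = ([t], mem)" and t: "t \<le> length mem"
    and mem: "distinct mem" "set mem \<in> \<I>1 \<inter> \<I>2"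
    using assms unfolding greedy_start_def by blast
  obtain bs where fold: "fold (arrival_step (auction K) \<I>1 \<I>2) ys ([t], mem) = ([t], mem @ bs)"
    and bs: "distinct (mem @ bs)" "set (mem @ bs) \<in> \<I>1 \<inter> \<I>2"
    using greedy_arrivals[OF mem] by metis
  have "length (mem @ bs) \<le> matroid_rank \<I>1"
    using bs by (intro length_le_rank) blast+
  then show ?thesis
    unfolding small_config_def c fold using t by auto
qed

lemma small_config_bidding:
  assumes "bidding_start i c"
  shows "small_config (fold (arrival_step (auction K) \<I>1 \<I>2) ys c)"
proof -
  obtain t S where c: "c = ([t, length S], S)" and t: "t \<le> length S"
    and S: "distinct S" "set S \<in> \<I>1 \<inter> \<I>2"
    using assms unfolding bidding_start_def by blast
  obtain F where
    fold: "fold (arrival_step (auction K) \<I>1 \<I>2) ys ([t, length S], S) = ([t, length S], S @ F)"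
    and F: "distinct (S @ F)" "set (S @ F) \<in> \<I>1"
    using bidding_arrivals[OF S t] by metis
  have "length (S @ F) \<le> matroid_rank \<I>1"
    using F by (rule length_le_rank)
  then show ?thesis
    unfolding small_config_def c fold using t by auto
qed

lemma small_config_auction:
  assumes "set xs = V" "c \<in> configs (auction K) \<I>1 \<I>2 xs"
  shows "small_config c"
proof -
  have *: "small_config (fold (arrival_step (auction K) \<I>1 \<I>2) ys (after_passes (auction K) \<I>1 \<I>2 xs p))"
    for ys p
  proof (cases "even p")
    case True
    then obtain i where "p = 2 * i" by blast
    then show ?thesis using small_config_greedy[OF after_passes_auction(1)[OF assms(1)]] by blast
  next
    case False
    then obtain i where "p = Suc (2 * i)" using oddE by fastforce
    then show ?thesis using small_config_bidding[OF after_passes_auction(2)[OF assms(1)]] by blast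
  qed
  \<comment> \<open>The empty list of arrivals accounts for the final configuration.\<close>
  show ?thesis using assms(2) *[of "[]"] * unfolding configs_def by auto
qed

lemma finite_configs: "finite (configs A \<I>1 \<I>2 xs)"
proof -
  have "{fold (arrival_step A \<I>1 \<I>2) (take i xs) (after_passes A \<I>1 \<I>2 xs p) | p i.
      p < num_passes A \<and> i \<le> length xs}
    = (\<lambda>(p, i). fold (arrival_step A \<I>1 \<I>2) (take i xs) (after_passes A \<I>1 \<I>2 xs p)) `
        ({..<num_passes A} \<times> {..length xs})"
    by auto
  then show ?thesis unfolding configs_def by simp
qed

lemma peak_elems_auction:
  assumes "set xs = V"
  shows "peak_elems (auction K) \<I>1 \<I>2 xs \<le> matroid_rank \<I>1"
proof -
  have "configs (auction K) \<I>1 \<I>2 xs \<noteq> {}" by (simp add: configs_def)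
  then show ?thesis
    unfolding peak_elems_def using finite_configs small_config_auction[OF assms]
    by (subst Max_le_iff) (auto simp: small_config_def)
qed

lemma peak_aux_bits_auction:
  assumes "set xs = V"
  shows "peak_aux_bits (auction K) \<I>1 \<I>2 xs \<le> 2 * (floorlog 2 (card V) + 1)"
proof -
  have "aux_bits (fst c) \<le> 2 * (floorlog 2 (card V) + 1)"
    if c: "c \<in> configs (auction K) \<I>1 \<I>2 xs" for c
  proof -
    obtain t s where ts: "fst c = [t] \<or> fst c = [t, s]" "t \<le> matroid_rank \<I>1" "s \<le> matroid_rank \<I>1"
      using small_config_auction[OF assms c] unfolding small_config_def by blast
    then have "floorlog 2 t \<le> floorlog 2 (card V)" "floorlog 2 s \<le> floorlog 2 (card V)"
      using M1.rank_le_card_ground by (auto intro!: floorlog_mono)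
    then show ?thesis using ts(1) by (auto simp: aux_bits_def)
  qed
  moreover have "configs (auction K) \<I>1 \<I>2 xs \<noteq> {}" by (simp add: configs_def)
  ultimately show ?thesis
    unfolding peak_aux_bits_def using finite_configs by (subst Max_le_iff) (auto simp: case_prod_unfold)
qed

text \<open>The bids accumulated in \<open>t\<close> are bounded by the size of the output and hence
  by \<open>opt\<close>.\<close>

lemma alg_result_auction:
  fixes K xs
  assumes "set xs = V"
  defines "S \<equiv> alg_result (auction K) \<I>1 \<I>2 xs"
  shows "S \<in> \<I>1 \<inter> \<I>2" and "2 * K * opt \<le> 3 * K * card S + opt"
proof -
  obtain t L where after: "after_passes (auction K) \<I>1 \<I>2 xs (Suc (2 * K)) = ([t, length L], L)"
    and L: "t \<le> length L" "distinct L" "set L \<in> \<I>1 \<inter> \<I>2" "2 * K * opt \<le> 3 * K * length L + t"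
    using after_passes_auction(2)[OF assms(1), of K K] unfolding bidding_start_def by blast
  have "S = set L"
    unfolding S_def alg_result_def using after nth_image_lessThan[of "length L" L]
    by (simp add: auction_def)
  moreover have "length L \<le> opt"
    using card_le_opt[OF L(3)] L(2) by (simp add: distinct_card)
  ultimately show "S \<in> \<I>1 \<inter> \<I>2" "2 * K * opt \<le> 3 * K * card S + opt"
    using L by (simp_all add: distinct_card)
qed

end

section \<open>Choice of constants\<close>

lemma floorlog_le_log: "real (floorlog 2 n) \<le> log 2 (real n + x + 2) + 1" if "0 \<le> x"
proof (cases "n = 0")
  case False
  then have "real (floorlog 2 n) = of_int \<lfloor>log 2 (real n)\<rfloor> + 1" by (simp add: floorlog_def)
  also have "\<dots> \<le> log 2 (real n) + 1" by simp
  also have "\<dots> \<le> log 2 (real n + x + 2) + 1" using False that by simp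
  finally show ?thesis .
qed (use that in \<open>simp add: floorlog_def\<close>)

lemma one_le_log: "1 \<le> log 2 (real n + x + 2)" if "0 \<le> x"
  using that by (subst le_log_iff) auto

theorem theorem3:
  "\<exists>C::real. \<forall>\<epsilon>::real. \<epsilon> > 0 \<longrightarrow>
     (\<exists>A::stream_alg.
        semi_streaming TYPE('a) A \<and>
        real (num_passes A) \<le> C / \<epsilon> \<and>
        (\<forall>(V::'a set) \<I>1 \<I>2 xs.
           matroid V \<I>1 \<and> matroid V \<I>2 \<and> stream_of xs V \<longrightarrow>
           (let r1 = matroid_rank \<I>1; r2 = matroid_rank \<I>2; r = max_common \<I>1 \<I>2;
                S = alg_result A \<I>1 \<I>2 xs
            in S \<in> \<I>1 \<inter> \<I>2 \<and>
               real (card S) \<ge> (2/3 - \<epsilon>) * real r \<and>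
               real (peak_elems A \<I>1 \<I>2 xs) \<le> C * (real (r1 + r2) / \<epsilon>) \<and>
               real (peak_aux_bits A \<I>1 \<I>2 xs)
                 \<le> C * (real (r1 + r2 + 1) / \<epsilon>) * log 2 (real (card V) + 1 / \<epsilon> + 2))))"
\<comment> \<open>The constant comes from the auxiliary data: two counters of at most
  \<open>L + 2\<close> bits each, and \<open>2 * (L + 2) \<le> 6 * L\<close> as
  \<open>L \<ge> 1\<close>.\<close>
proof (rule exI[of _ 6], intro allI impI)
  fix \<epsilon> :: real assume \<epsilon>: "\<epsilon> > 0"
  show "\<exists>A. semi_streaming TYPE('a) A \<and> real (num_passes A) \<le> 6 / \<epsilon> \<and>
    (\<forall>(V::'a set) \<I>1 \<I>2 xs.
      matroid V \<I>1 \<and> matroid V \<I>2 \<and> stream_of xs V \<longrightarrow>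
      (let r1 = matroid_rank \<I>1; r2 = matroid_rank \<I>2; r = max_common \<I>1 \<I>2;
           S = alg_result A \<I>1 \<I>2 xs
       in S \<in> \<I>1 \<inter> \<I>2 \<and>
          real (card S) \<ge> (2/3 - \<epsilon>) * real r \<and>
          real (peak_elems A \<I>1 \<I>2 xs) \<le> 6 * (real (r1 + r2) / \<epsilon>) \<and>
          real (peak_aux_bits A \<I>1 \<I>2 xs)
            \<le> 6 * (real (r1 + r2 + 1) / \<epsilon>) * log 2 (real (card V) + 1 / \<epsilon> + 2)))"
  proof (cases "\<epsilon> < 2 / 3")
    case False
    \<comment> \<open>The required size is at most 0, so the empty set suffices. For large
      \<open>\<epsilon>\<close> the bounds allow neither a pass nor, on an empty ground set, the one
      bit that a stored zero costs; hence no passes and an empty list.\<close>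
    define A where "A = (auction 0)\<lparr>init_aux := [], num_passes := 0\<rparr>"
    have A: "after_passes A \<I>1 \<I>2 xs 0 = ([], [])" "num_passes A = 0"
      for \<I>1 \<I>2 :: "'a set set" and xs
      by (simp_all add: A_def after_passes_def)
    then have "configs A \<I>1 \<I>2 xs = {([], [])}" for \<I>1 \<I>2 :: "'a set set" and xs
      by (simp add: configs_def)
    then have peak: "peak_elems A \<I>1 \<I>2 xs = 0" "peak_aux_bits A \<I>1 \<I>2 xs = 0"
      for \<I>1 \<I>2 :: "'a set set" and xs
      by (simp_all add: peak_elems_def peak_aux_bits_def aux_bits_def)
    have res: "alg_result A \<I>1 \<I>2 xs = {}" for \<I>1 \<I>2 :: "'a set set" and xs
      by (simp add: alg_result_def A)
    show ?thesis
    proof (intro exI[of _ A] conjI allI impI)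
      show "semi_streaming TYPE('a) A"
        unfolding semi_streaming_def peak by (intro exI[of _ 0]) simp
      show "real (num_passes A) \<le> 6 / \<epsilon>" using A \<epsilon> by simp
      fix V :: "'a set" and \<I>1 \<I>2 xs
      assume "matroid V \<I>1 \<and> matroid V \<I>2 \<and> stream_of xs V"
      then have "{} \<in> \<I>1 \<inter> \<I>2" using matroid.empty_indep by blast
      moreover have "(2/3 - \<epsilon>) * real (max_common \<I>1 \<I>2) \<le> 0"
        using False by (intro mult_nonpos_nonneg) auto
      moreover have "log 2 (real (card V) + 1 / \<epsilon> + 2) \<ge> 0"
        using one_le_log[of "1 / \<epsilon>" "card V"] \<epsilon> by simp
      ultimately show "let r1 = matroid_rank \<I>1; r2 = matroid_rank \<I>2; r = max_common \<I>1 \<I>2;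
           S = alg_result A \<I>1 \<I>2 xs
       in S \<in> \<I>1 \<inter> \<I>2 \<and>
          real (card S) \<ge> (2/3 - \<epsilon>) * real r \<and>
          real (peak_elems A \<I>1 \<I>2 xs) \<le> 6 * (real (r1 + r2) / \<epsilon>) \<and>
          real (peak_aux_bits A \<I>1 \<I>2 xs)
            \<le> 6 * (real (r1 + r2 + 1) / \<epsilon>) * log 2 (real (card V) + 1 / \<epsilon> + 2)"
        using \<epsilon> by (simp add: Let_def peak res)
    qed
  next
    case True
    \<comment> \<open>Dividing \<open>2 * K * opt \<le> 3 * K * card S + opt\<close> by
      \<open>3 * K\<close> leaves an error of \<open>opt / (3 * K)\<close>, which is at most
      \<open>\<epsilon> * opt\<close>.\<close>
    define K where "K = nat \<lceil>1 / (3 * \<epsilon>)\<rceil>"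
    have K: "1 / (3 * \<epsilon>) \<le> real K" "real K \<le> 1 / (3 * \<epsilon>) + 1"
      using \<epsilon> unfolding K_def by (auto simp: le_of_int_ceiling)
    show ?thesis
    proof (intro exI[of _ "auction K"] conjI allI impI)
      show "semi_streaming TYPE('a) (auction K)"
        unfolding semi_streaming_def
      proof (rule exI[of _ 1], rule exI[of _ 0], intro allI impI)
        fix V :: "'a set" and \<I>1 \<I>2 xs
        assume hyp: "matroid V \<I>1 \<and> matroid V \<I>2 \<and> stream_of xs V"
        then interpret two_matroids V \<I>1 \<I>2 by (simp add: two_matroids_def)
        show "let R = real (matroid_rank \<I>1 + matroid_rank \<I>2)
          in real (peak_elems (auction K) \<I>1 \<I>2 xs) \<le> 1 * R * log 2 (R + 2) ^ 0"
          using peak_elems_auction[of xs K] hyp by (simp add: stream_of_def)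
      qed
      have "real (num_passes (auction K)) = 2 * real K + 1" by (simp add: auction_def)
      also have "\<dots> \<le> 2 / (3 * \<epsilon>) + 3" using K(2) by simp
      \<comment> \<open>From \<open>\<epsilon> < 2 / 3\<close> the additive 3 is below
        \<open>2 / \<epsilon>\<close>.\<close>
      also have "\<dots> \<le> 6 / \<epsilon>" using \<epsilon> True by (simp add: field_simps)
      finally show "real (num_passes (auction K)) \<le> 6 / \<epsilon>" .
      fix V :: "'a set" and \<I>1 \<I>2 xs
      assume hyp: "matroid V \<I>1 \<and> matroid V \<I>2 \<and> stream_of xs V"
      then interpret two_matroids V \<I>1 \<I>2 by (simp add: two_matroids_def)
      have xs: "set xs = V" using hyp by (simp add: stream_of_def)
      define S where "S = alg_result (auction K) \<I>1 \<I>2 xs"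
      define R where "R = matroid_rank \<I>1 + matroid_rank \<I>2"
      define L where "L = log 2 (real (card V) + 1 / \<epsilon> + 2)"
      have S: "S \<in> \<I>1 \<inter> \<I>2" "2 * K * opt \<le> 3 * K * card S + opt"
        unfolding S_def using alg_result_auction[OF xs] by auto
      have approx: "(2/3 - \<epsilon>) * real opt \<le> real (card S)"
      proof -
        have K_pos: "real K > 0" using K(1) \<epsilon> by (smt (verit) divide_pos_pos)
        have "1 \<le> 3 * \<epsilon> * real K" using K(1) \<epsilon> by (simp add: field_simps)
        then have "real opt \<le> 3 * \<epsilon> * real K * real opt"
          using mult_right_mono[of 1 _ "real opt"] by simp
        moreover have "real (2 * K * opt) \<le> real (3 * K * card S + opt)"
          using S(2) by (simp only: of_nat_le_iff)
        ultimately have "3 * real K * ((2/3 - \<epsilon>) * real opt) \<le> 3 * real K * real (card S)"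
          by (simp add: algebra_simps)
        then show ?thesis using K_pos by simp
      qed
      have peak: "real (peak_elems (auction K) \<I>1 \<I>2 xs) \<le> 6 * (real R / \<epsilon>)"
      proof -
        have "real (peak_elems (auction K) \<I>1 \<I>2 xs) \<le> real R"
          using peak_elems_auction[OF xs, of K] by (simp add: R_def)
        also have "\<dots> \<le> real R * (6 / \<epsilon>)"
          using mult_left_mono[of 1 "6 / \<epsilon>" "real R"] \<epsilon> True by (simp add: field_simps)
        finally show ?thesis by (simp add: mult.commute)
      qed
      have bits: "real (peak_aux_bits (auction K) \<I>1 \<I>2 xs) \<le> 6 * (real (R + 1) / \<epsilon>) * L"
      proof -
        have "L \<ge> 1" using \<epsilon> unfolding L_def by (intro one_le_log) simp
        have "real (peak_aux_bits (auction K) \<I>1 \<I>2 xs) \<le> real (2 * (floorlog 2 (card V) + 1))"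
          using peak_aux_bits_auction[OF xs, of K] by (simp only: of_nat_le_iff)
        also have "\<dots> \<le> 6 * L"
          using floorlog_le_log[of "1 / \<epsilon>" "card V"] \<epsilon> \<open>L \<ge> 1\<close> unfolding L_def by simp
        also have "\<dots> \<le> 6 * (real (R + 1) / \<epsilon>) * L"
        proof -
          have "1 \<le> real (R + 1) / \<epsilon>" using \<epsilon> True by (simp add: field_simps)
          then show ?thesis using \<open>L \<ge> 1\<close> mult_right_mono[of 1 "real (R + 1) / \<epsilon>" L] by linarith
        qed
        finally show ?thesis .
      qed
      show "let r1 = matroid_rank \<I>1; r2 = matroid_rank \<I>2; r = max_common \<I>1 \<I>2;
           S = alg_result (auction K) \<I>1 \<I>2 xs
       in S \<in> \<I>1 \<inter> \<I>2 \<and>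
          real (card S) \<ge> (2/3 - \<epsilon>) * real r \<and>
          real (peak_elems (auction K) \<I>1 \<I>2 xs) \<le> 6 * (real (r1 + r2) / \<epsilon>) \<and>
          real (peak_aux_bits (auction K) \<I>1 \<I>2 xs)
            \<le> 6 * (real (r1 + r2 + 1) / \<epsilon>) * log 2 (real (card V) + 1 / \<epsilon> + 2)"
        unfolding Let_def using S(1) approx peak bits by (simp only: S_def R_def L_def opt_def)
    qed
  qed
qed

end
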